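(* For any positive integers $n$ and $s$, let $\mathcal A\subset 2^{[n]}$ be an even-sized family with $|\mathcal A|\ge 2^{\lfloor n/2\rfloor}+s$. Then $op(\mathcal A)>s\cdot 2^{\lfloor n/2\rfloor-2}$.
   Context: $[n]=\{1,2,\ldots,n\}$ and $2^{[n]}$ is the collection of all subsets of $[n]$. A family $\mathcal A\subset 2^{[n]}$ is a set of (distinct) subsets of $[n]$; it is even-sized if every member has even cardinality. The odd pair number $op(\mathcal A)$ is the number of (unordered) pairs of distinct members $A,B\in\mathcal A$ such that $|A\cap B|$ is odd. *)

theory Defs
  imports Complex_Main
begin

definition even_sized :: "'a set set \<Rightarrow> bool" where
  "even_sized \<A> \<longleftrightarrow> (\<forall>A\<in>\<A>. even (card A))"

(* Each unordered pair of distinct members is encoded as the two-element set {A, B}. *)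
definition odd_pair_number :: "'a set set \<Rightarrow> nat" where
  "odd_pair_number \<A> =
     card {{A, B} | A B. A \<in> \<A> \<and> B \<in> \<A> \<and> A \<noteq> B \<and> odd (card (A \<inter> B))}"

end

theory Submission
  imports Defs "HOL-Analysis.Convex"
begin

text \<open>
  Identify a set with its indicator vector over the field with two elements, so that the parity of
  \<open>card (x \<inter> y)\<close> becomes a bilinear form. The matrix of signs \<open>(-1) ^ card (x \<inter> y)\<close> over all
  \<open>x, y \<subseteq> V\<close>, with \<open>card V = n\<close>, is a Hadamard matrix: its rows are pairwise orthogonal. The sum
  \<open>S\<close> of its entries over \<open>\<A> \<times> \<A>\<close> is therefore small: with \<open>a = card \<A>\<close>, Cauchy-Schwarz and
  Parseval give \<open>S\<^sup>2 \<le> 2 ^ n * a\<^sup>2\<close>, that is \<open>S \<le> 2 ^ (n div 2) * a\<close> for even \<open>n\<close>.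

  For odd \<open>n\<close> this loses a factor \<open>sqrt 2\<close>, which evenness of the members restores. Complementing
  \<open>y\<close> does not change the parity of its intersection with a set of even size, and it turns even
  sets into odd ones. So the row sums over \<open>\<A>\<close> take each of their values twice, once at a
  member and once at its complement, and only half of the total square mass sits on \<open>\<A>\<close>.

  On the other hand the entries over \<open>\<A> \<times> \<A>\<close> are \<open>1\<close> except for two \<open>-1\<close> entries per odd pair, as
  an even set meets itself evenly; so \<open>S = a\<^sup>2 - 4 * op\<close>. Comparing the two,
  \<open>4 * op \<ge> a * (a - 2 ^ (n div 2)) \<ge> (2 ^ (n div 2) + s) * s > 2 ^ (n div 2) * s\<close>.
\<close>

definition intersection_sign :: "'a set \<Rightarrow> 'a set \<Rightarrow> real" where
  "intersection_sign x y = (-1) ^ card (x \<inter> y)"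

section \<open>Orthogonality of the intersection signs\<close>

text \<open>Each sign is a character: it is multiplicative over the points of its second argument. This
  lets the sum over all subsets in the next lemma factor into a product over points.\<close>

lemma intersection_sign_eq_prod:
  assumes "finite y"
  shows "intersection_sign x y = (\<Prod>i\<in>y. if i \<in> x then -1 else 1)"
proof -
  have "(\<Prod>i\<in>y. if i \<in> x then -1 else (1::real)) = (\<Prod>i\<in>y \<inter> x. -1)"
    using assms by (rule prod.inter_restrict[symmetric])
  then show ?thesis
    by (simp add: intersection_sign_def Int_commute)
qed

text \<open>A point in exactly one of \<open>x\<close> and \<open>y\<close> contributes a factor \<open>-1 + 1 = 0\<close>, every other point a
  factor \<open>2\<close>.\<close>

lemma intersection_sign_orthogonal:
  assumes "finite V" "x \<subseteq> V" "y \<subseteq> V"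
  shows "(\<Sum>z\<in>Pow V. intersection_sign x z * intersection_sign y z) =
    (if x = y then 2 ^ card V else 0)"
proof -
  define e :: "'a \<Rightarrow> real" where
    "e i = (if i \<in> x then -1 else 1) * (if i \<in> y then -1 else 1)" for i
  have "(\<Sum>z\<in>Pow V. intersection_sign x z * intersection_sign y z) = (\<Sum>z\<in>Pow V. \<Prod>i\<in>z. e i)"
    using assms(1)
    by (intro sum.cong)
       (auto simp: intersection_sign_eq_prod finite_subset e_def simp flip: prod.distrib)
  also have "\<dots> = (\<Prod>i\<in>V. e i + 1)"
    using prod_add[OF assms(1), of e "\<lambda>_. 1"] by simp
  also have "\<dots> = (if x = y then 2 ^ card V else 0)"
  proof (cases "x = y")
    case True
    then have "e i + 1 = 2" for i
      by (simp add: e_def)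
    with True show ?thesis by simp
  next
    case False
    then obtain i where "i \<in> x \<longleftrightarrow> i \<notin> y" by blast
    with assms have "i \<in> V" "e i + 1 = 0"
      by (auto simp: e_def)
    with False assms(1) show ?thesis
      by (auto intro: prod_zero)
  qed
  finally show ?thesis .
qed

text \<open>Parseval's identity for the indicator function of \<open>\<A>\<close>.\<close>

lemma intersection_sign_parseval:
  assumes "finite V" "\<A> \<subseteq> Pow V"
  shows "(\<Sum>z\<in>Pow V. (\<Sum>x\<in>\<A>. intersection_sign x z)\<^sup>2) = 2 ^ card V * real (card \<A>)"
proof -
  have fin: "finite \<A>"
    using assms by (meson finite_Pow_iff finite_subset)
  have "(\<Sum>z\<in>Pow V. (\<Sum>x\<in>\<A>. intersection_sign x z)\<^sup>2) =
      (\<Sum>z\<in>Pow V. \<Sum>x\<in>\<A>. \<Sum>y\<in>\<A>. intersection_sign x z * intersection_sign y z)"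
    by (simp add: power2_eq_square sum_product)
  also have "\<dots> = (\<Sum>x\<in>\<A>. \<Sum>z\<in>Pow V. \<Sum>y\<in>\<A>. intersection_sign x z * intersection_sign y z)"
    by (rule sum.swap)
  also have "\<dots> = (\<Sum>x\<in>\<A>. \<Sum>y\<in>\<A>. \<Sum>z\<in>Pow V. intersection_sign x z * intersection_sign y z)"
    by (intro sum.cong refl sum.swap)
  also have "\<dots> = (\<Sum>x\<in>\<A>. \<Sum>y\<in>\<A>. if x = y then 2 ^ card V else 0)"
    using assms by (intro sum.cong refl intersection_sign_orthogonal) auto
  also have "\<dots> = 2 ^ card V * real (card \<A>)"
    using fin by simp
  finally show ?thesis .
qed

section \<open>The sign sum over an even-sized family\<close>

lemma intersection_sign_complement:
  assumes "finite V" "x \<subseteq> V" "even (card x)"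
  shows "intersection_sign x (V - y) = intersection_sign x y"
proof -
  have "finite x"
    using assms finite_subset by blast
  moreover have "x \<inter> (V - y) = x - y"
    using assms(2) by blast
  ultimately have "card x = card (x \<inter> y) + card (x \<inter> (V - y))"
    by (metis card_Int_Diff)
  with assms(3) have "even (card (x \<inter> (V - y))) \<longleftrightarrow> even (card (x \<inter> y))"
    by presburger
  then show ?thesis
    by (auto simp: intersection_sign_def minus_one_power_iff)
qed

text \<open>The exponent is \<open>card V\<close> for even \<open>card V\<close> and \<open>card V - 1\<close> for odd \<open>card V\<close>. In the odd case
  the members and their complements are disjoint families with the same sums, so that \<open>\<A>\<close> carries
  at most half of the total in Parseval's identity.\<close>

lemma sum_squares_over_even_family:
  assumes "finite V" "\<A> \<subseteq> Pow V" "even_sized \<A>"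
  shows "(\<Sum>y\<in>\<A>. (\<Sum>x\<in>\<A>. intersection_sign x y)\<^sup>2) \<le> 2 ^ (2 * (card V div 2)) * real (card \<A>)"
proof -
  define f where "f y = (\<Sum>x\<in>\<A>. intersection_sign x y)\<^sup>2" for y
  have parseval: "(\<Sum>z\<in>Pow V. f z) = 2 ^ card V * real (card \<A>)"
    unfolding f_def using assms by (intro intersection_sign_parseval)
  have fin: "finite \<A>"
    using assms by (meson finite_Pow_iff finite_subset)
  have f_nonneg: "f z \<ge> 0" for z
    by (simp add: f_def)
  have "(\<Sum>y\<in>\<A>. f y) \<le> 2 ^ (2 * (card V div 2)) * real (card \<A>)"
  proof (cases "even (card V)")
    case True
    have "(\<Sum>y\<in>\<A>. f y) \<le> (\<Sum>z\<in>Pow V. f z)"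
      using assms f_nonneg by (intro sum_mono2) auto
    with True parseval show ?thesis by simp
  next
    case False
    define \<C> where "\<C> = (\<lambda>y. V - y) ` \<A>"
    have disj: "\<A> \<inter> \<C> = {}"
    proof -
      have "V - y \<notin> \<A>" if "y \<in> \<A>" for y
      proof
        assume "V - y \<in> \<A>"
        with that assms have "even (card y)" "even (card (V - y))"
          by (auto simp: even_sized_def)
        moreover have "card V = card y + card (V - y)"
          using that assms by (metis PowD card_Diff_subset card_mono finite_subset
              le_add_diff_inverse subsetD)
        ultimately show False using False by simp
      qed
      then show ?thesis by (auto simp: \<C>_def)
    qed
    have inj: "inj_on (\<lambda>y. V - y) \<A>"
      using assms(2) by (intro inj_onI) blast
    have "(\<Sum>y\<in>\<C>. f y) = (\<Sum>y\<in>\<A>. f (V - y))"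
      unfolding \<C>_def using inj by (simp add: sum.reindex)
    also have "\<dots> = (\<Sum>y\<in>\<A>. f y)"
      using assms unfolding f_def even_sized_def
      by (intro sum.cong refl arg_cong[where f = "\<lambda>t. t\<^sup>2"] intersection_sign_complement) auto
    finally have "2 * (\<Sum>y\<in>\<A>. f y) = (\<Sum>y\<in>\<A> \<union> \<C>. f y)"
      using fin disj by (subst sum.union_disjoint) (auto simp: \<C>_def)
    also have "\<dots> \<le> (\<Sum>z\<in>Pow V. f z)"
      using assms f_nonneg by (intro sum_mono2) (auto simp: \<C>_def)
    also have "\<dots> = 2 * (2 ^ (2 * (card V div 2)) * real (card \<A>))"
      
    proof -
      have "card V = Suc (2 * (card V div 2))"
        using False by presburger
      then have "(2::real) ^ card V = 2 * 2 ^ (2 * (card V div 2))"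
        by (metis power_Suc)
      with parseval show ?thesis by simp
    qed
    finally show ?thesis by simp
  qed
  then show ?thesis by (simp add: f_def)
qed

lemma intersection_sign_sum_le:
  assumes "finite V" "\<A> \<subseteq> Pow V" "even_sized \<A>"
  shows "(\<Sum>y\<in>\<A>. \<Sum>x\<in>\<A>. intersection_sign x y) \<le> 2 ^ (card V div 2) * real (card \<A>)"
proof (rule power2_le_imp_le)
  have "(\<Sum>y\<in>\<A>. \<Sum>x\<in>\<A>. intersection_sign x y)\<^sup>2
      \<le> (\<Sum>y\<in>\<A>. (\<Sum>x\<in>\<A>. intersection_sign x y)\<^sup>2) * real (card \<A>)"
    by (rule sum_squared_le_sum_of_squares)
  also have "\<dots> \<le> 2 ^ (2 * (card V div 2)) * real (card \<A>) * real (card \<A>)"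
    using assms by (intro mult_right_mono sum_squares_over_even_family) auto
  also have "\<dots> = (2 ^ (card V div 2) * real (card \<A>))\<^sup>2"
    by (simp add: power_mult_distrib power_even_eq power2_eq_square)
  finally show "(\<Sum>y\<in>\<A>. \<Sum>x\<in>\<A>. intersection_sign x y)\<^sup>2 \<le> (2 ^ (card V div 2) * real (card \<A>))\<^sup>2" .
qed simp

section \<open>Counting odd pairs\<close>

text \<open>Evenness of the members excludes the diagonal, so each odd pair is hit by exactly two ordered
  pairs.\<close>

lemma card_ordered_odd_pairs:
  assumes "finite \<A>" "even_sized \<A>"
  shows "card {(x, y) \<in> \<A> \<times> \<A>. odd (card (x \<inter> y))} = 2 * odd_pair_number \<A>"
proof -
  define P where "P = {(x, y) \<in> \<A> \<times> \<A>. odd (card (x \<inter> y))}"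
  define U where "U = (\<lambda>(x, y). {x, y}) ` P"
  have fin: "finite P"
    unfolding P_def by (rule finite_subset[of _ "\<A> \<times> \<A>"]) (use assms(1) in auto)
  have off_diagonal: "x \<noteq> y" if "(x, y) \<in> P" for x y
    using that assms(2) by (auto simp: P_def even_sized_def)
  have "{{x, y} | x y. x \<in> \<A> \<and> y \<in> \<A> \<and> x \<noteq> y \<and> odd (card (x \<inter> y))} = U"
  proof (intro equalityI subsetI)
    fix u assume "u \<in> {{x, y} | x y. x \<in> \<A> \<and> y \<in> \<A> \<and> x \<noteq> y \<and> odd (card (x \<inter> y))}"
    then obtain x y where "u = {x, y}" "(x, y) \<in> P"
      by (auto simp: P_def)
    then show "u \<in> U"
      by (auto simp: U_def)
  next
    fix u assume "u \<in> U"
    then obtain x y where xy: "u = {x, y}" "(x, y) \<in> P"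
      by (auto simp: U_def)
    then have "x \<in> \<A>" "y \<in> \<A>" "odd (card (x \<inter> y))"
      by (auto simp: P_def)
    moreover have "x \<noteq> y"
      using xy(2) by (rule off_diagonal)
    ultimately show "u \<in> {{x, y} | x y. x \<in> \<A> \<and> y \<in> \<A> \<and> x \<noteq> y \<and> odd (card (x \<inter> y))}"
      using xy(1) by auto
  qed
  then have op: "odd_pair_number \<A> = card U"
    by (simp add: odd_pair_number_def)
  have two: "card {p \<in> P. (case p of (x, y) \<Rightarrow> {x, y}) = u} = 2" if u: "u \<in> U" for u
  proof -
    obtain x y where xy: "(x, y) \<in> P" "u = {x, y}"
      using u by (auto simp: U_def)
    then have "(y, x) \<in> P"
      by (auto simp: P_def Int_commute)
    with xy have "{p \<in> P. (case p of (x, y) \<Rightarrow> {x, y}) = u} = {(x, y), (y, x)}"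
      by (auto simp: doubleton_eq_iff)
    with off_diagonal[OF xy(1)] show ?thesis by simp
  qed
  have "card P = (\<Sum>p\<in>P. card {u \<in> U. (case p of (x, y) \<Rightarrow> {x, y}) = u})"
  proof -
    have "{u \<in> U. (case p of (x, y) \<Rightarrow> {x, y}) = u} = {case p of (x, y) \<Rightarrow> {x, y}}" if "p \<in> P" for p
      using that by (auto simp: U_def)
    then show ?thesis by simp
  qed
  also have "\<dots> = 2 * card U"
    using fin two by (intro sum_multicount) (auto simp: U_def)
  finally show ?thesis
    by (simp add: op P_def)
qed

lemma intersection_sign_sum_eq:
  assumes "finite \<A>" "even_sized \<A>"
  shows "(\<Sum>y\<in>\<A>. \<Sum>x\<in>\<A>. intersection_sign x y) =
    (real (card \<A>))\<^sup>2 - 4 * real (odd_pair_number \<A>)"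
proof -
  let ?P = "{(x, y) \<in> \<A> \<times> \<A>. odd (card (x \<inter> y))}"
  have "(\<Sum>y\<in>\<A>. \<Sum>x\<in>\<A>. intersection_sign x y) =
      (\<Sum>p\<in>\<A> \<times> \<A>. 1 - 2 * (if p \<in> ?P then 1 else 0))"
    unfolding sum.cartesian_product
    by (intro sum.cong) (auto simp: intersection_sign_def minus_one_power_iff Int_commute)
  also have "\<dots> = real (card (\<A> \<times> \<A>)) - 2 * (\<Sum>p\<in>\<A> \<times> \<A>. if p \<in> ?P then 1 else 0)"
    by (simp add: sum_subtractf flip: sum_distrib_left)
  also have "(\<Sum>p\<in>\<A> \<times> \<A>. if p \<in> ?P then 1 else (0::real)) = real (card ?P)"
  proof -
    have "(\<A> \<times> \<A>) \<inter> ?P = ?P" by auto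
    then show ?thesis
      using assms(1) by (subst sum.inter_restrict[symmetric]) auto
  qed
  finally show ?thesis
    using card_ordered_odd_pairs[OF assms]
    by (simp add: card_cartesian_product power2_eq_square)
qed

theorem theorem1p7:
  fixes n s :: nat and \<A> :: "nat set set"
  assumes "n > 0" and "s > 0"
    and "\<A> \<subseteq> Pow {1..n}"
    and "even_sized \<A>"
    and "card \<A> \<ge> 2 ^ (n div 2) + s"
  shows "real (odd_pair_number \<A>) > real s * 2 powi (int (n div 2) - 2)"
proof -
  define M :: real where "M = 2 ^ (n div 2)"
  define a where "a = real (card \<A>)"
  have fin: "finite \<A>"
    using assms(3) by (meson finite_Pow_iff finite_atLeastAtMost finite_subset)
  have "M > 0" by (simp add: M_def)
  have a: "M + real s \<le> a"
  proof -
    have "real (2 ^ (n div 2) + s) \<le> a"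
      unfolding a_def using assms(5) by (rule of_nat_mono)
    then show ?thesis by (simp add: M_def)
  qed
  have "a\<^sup>2 - 4 * real (odd_pair_number \<A>) \<le> M * a"
    using intersection_sign_sum_le[of "{1..n}" \<A>] intersection_sign_sum_eq[OF fin assms(4)] assms(3,4)
    by (simp add: M_def a_def)
  then have "a * (a - M) \<le> 4 * real (odd_pair_number \<A>)"
    by (simp add: algebra_simps power2_eq_square)
  moreover have "(M + real s) * real s \<le> a * (a - M)"
    using a \<open>M > 0\<close> by (intro mult_mono) auto
  moreover have "M * real s < (M + real s) * real s"
    using assms(2) by simp
  ultimately have "M * real s < 4 * real (odd_pair_number \<A>)"
    by linarith
  then have "real s * (M / 4) < real (odd_pair_number \<A>)"
    by (simp add: field_simps)
  moreover have "(2::real) powi (int (n div 2) - 2) = M / 4"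
    by (simp add: M_def power_int_diff)
  ultimately show ?thesis by (simp only:)
qed

end
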